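(* Let $0<\alpha<1$. (Maximum principle) Let $\varphi$ be a real-valued function in the Schwartz class $\mathcal{S}(\mathbb{R})$ such that $\varphi(x_0)=0$ for some $x_0\in\mathbb{R}$ and $\varphi(x)\ge 0$ for all $x\ge x_0$. Then $(D_{\rm right})^\alpha\varphi(x_0)\le 0$. Moreover, $(D_{\rm right})^\alpha\varphi(x_0)=0$ if and only if $\varphi(x)=0$ for all $x\ge x_0$. (Comparison principle) Let $\varphi,\psi\in\mathcal{S}(\mathbb{R})$ be real-valued functions such that $\varphi(x_0)=\psi(x_0)$ for some $x_0\in\mathbb{R}$ and $\varphi(x)\ge\psi(x)$ for all $x\ge x_0$. Then $(D_{\rm right})^\alpha\varphi(x_0)\le(D_{\rm right})^\alpha\psi(x_0)$. Moreover, $(D_{\rm right})^\alpha\varphi(x_0)=(D_{\rm right})^\alpha\psi(x_0)$ if and only if $\varphi(x)=\psi(x)$ for all $x\ge x_0$.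
   Context: For $0<\alpha<1$ and $\varphi\in\mathcal{S}(\mathbb{R})$, the fractional derivative from the right is the absolutely convergent integral $$(D_{\rm right})^\alpha\varphi(x)=\frac{1}{\Gamma(-\alpha)}\int_x^\infty\frac{\varphi(t)-\varphi(x)}{(t-x)^{1+\alpha}}\,dt,\qquad x\in\mathbb{R}.$$ Here $\Gamma(-\alpha)=\Gamma(1-\alpha)/(-\alpha)<0$. *)

theory Defs
  imports "HOL-Analysis.Analysis"
begin

definition higher_vderiv :: "nat \<Rightarrow> (real \<Rightarrow> 'a::real_normed_vector) \<Rightarrow> real \<Rightarrow> 'a" where
  "higher_vderiv n = (\<lambda>f x. vector_derivative f (at x)) ^^ n"

text \<open>Since \<^const>\<open>vector_derivative\<close> is total, smoothness is required explicitly: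
  every iterated derivative is differentiable everywhere.\<close>
definition schwartz :: "(real \<Rightarrow> 'a::real_normed_vector) set" where
  "schwartz = {f. (\<forall>n x. higher_vderiv n f differentiable (at x)) \<and>
                  (\<forall>m n. bounded (range (\<lambda>x. x ^ m *\<^sub>R higher_vderiv n f x)))}"

text \<open>The integral is a Lebesgue (hence absolutely convergent) integral. For a Schwartz function
  and \<open>0 < \<alpha> < 1\<close> the integrand is integrable, so the default value \<open>0\<close> of the Bochner integral
  plays no role there.\<close>
definition D_right :: "real \<Rightarrow> (real \<Rightarrow> 'a::{banach, second_countable_topology}) \<Rightarrow> real \<Rightarrow> 'a" where
  "D_right \<alpha> \<phi> x =
     (1 / Gamma (- \<alpha>)) *\<^sub>R
       (LINT t:{x<..}|lborel. (\<phi> t - \<phi> x) /\<^sub>R (t - x) powr (1 + \<alpha>))"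

end

theory Submission
  imports Defs
begin

text \<open>The difference of the two fractional derivatives at \<^term>\<open>x0\<close> is \<open>1 / \<Gamma>(-\<alpha>) < 0\<close> times the
  integral over \<open>(x0, \<infinity>)\<close> of the continuous nonnegative function
  \<open>(\<phi> - \<psi>)(t) / (t - x0)^(1+\<alpha>)\<close>, so it is nonpositive and vanishes exactly when the integrand does.
  The maximum principle is the case \<open>\<psi> = 0\<close>.\<close>

lemma schwartz_bounded:
  assumes "f \<in> schwartz"
  shows "bounded (range f)"
proof -
  have "bounded (range (\<lambda>x. x ^ 0 *\<^sub>R higher_vderiv 0 f x))"
    using assms unfolding schwartz_def by blast
  then show ?thesis
    by (simp add: higher_vderiv_def)
qed

lemma schwartz_has_vector_derivative:
  assumes "f \<in> schwartz"
  shows "(f has_vector_derivative vector_derivative f (at x)) (at x within S)"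
proof -
  have "higher_vderiv 0 f differentiable (at x)"
    using assms unfolding schwartz_def by blast
  then show ?thesis
    by (auto simp: higher_vderiv_def vector_derivative_works intro: has_vector_derivative_at_within)
qed

lemma schwartz_continuous_on:
  assumes "f \<in> schwartz"
  shows "continuous_on S f"
  using schwartz_has_vector_derivative[OF assms]
  by (meson continuous_on_eq_continuous_within has_vector_derivative_continuous)

text \<open>The mean value inequality applied to the bounded first derivative. The resulting linear
  bound tames the singularity of the kernel at \<open>t = x\<close>.\<close>

lemma schwartz_lipschitz:
  assumes "f \<in> schwartz"
  obtains C where "\<And>x y. norm (f y - f x) \<le> C * \<bar>y - x\<bar>"
proof -
  have "bounded (range (\<lambda>x. x ^ 0 *\<^sub>R higher_vderiv 1 f x))"
    using assms unfolding schwartz_def by blast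
  then obtain C where C: "\<And>x. norm (vector_derivative f (at x)) \<le> C"
    by (auto simp: higher_vderiv_def bounded_iff)
  have "norm (f y - f x) \<le> C * norm (y - x)" for x y
  proof (rule differentiable_bound[OF convex_UNIV])
    show "(f has_derivative (\<lambda>h. h *\<^sub>R vector_derivative f (at z))) (at z)" for z
      using schwartz_has_vector_derivative[OF assms] by (simp add: has_vector_derivative_def)
    show "onorm (\<lambda>h. h *\<^sub>R vector_derivative f (at z)) \<le> C" for z
      using C[of z] by (simp add: onorm_scaleR_left[OF bounded_linear_ident] onorm_id)
  qed auto
  then show thesis
    by (intro that) (simp add: real_norm_def)
qed

lemma zero_in_schwartz: "(\<lambda>_. 0 :: 'a::real_normed_vector) \<in> schwartz"
proof -
  have "higher_vderiv n (\<lambda>_. 0 :: 'a) = (\<lambda>_. 0)" for n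
    by (induction n) (auto simp: higher_vderiv_def)
  then show ?thesis
    by (simp add: schwartz_def image_def)
qed

text \<open>For a nonnegative function, gauge integrability is already absolute, hence gives
  integrability for the completed measure; Borel measurability brings this down to
  \<open>lborel\<close>. It turns known gauge integrals of powers into dominating functions.\<close>

lemma set_integrable_lborel_if_nonneg_integrable_on:
  fixes f :: "'a::euclidean_space \<Rightarrow> real"
  assumes "f integrable_on A" "\<And>x. x \<in> A \<Longrightarrow> 0 \<le> f x" "set_borel_measurable lborel A f"
  shows "set_integrable lborel A f"
  using nonnegative_absolutely_integrable_1[OF assms(1,2)] assms(3)
  by (simp add: set_integrable_def set_borel_measurable_def integrable_completion)

text \<open>This is what allows two fractional derivatives to be subtracted under one integral sign.
  The Lipschitz bound controls the singularity, boundedness of \<open>f\<close> controls the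
  tail.\<close>

lemma D_right_integrable:
  fixes f :: "real \<Rightarrow> 'a::{banach, second_countable_topology}"
  assumes "0 < \<alpha>" "\<alpha> < 1" and f: "f \<in> schwartz"
  shows "set_integrable lborel {x<..} (\<lambda>t. (f t - f x) /\<^sub>R (t - x) powr (1 + \<alpha>))"
proof -
  \<comment> \<open>The integrand after the substitution \<open>t = x + u\<close>, which moves the
    singularity to \<open>0\<close>.\<close>
  let ?g = "\<lambda>u. (f (x + u) - f x) /\<^sub>R u powr (1 + \<alpha>)"
  obtain B where B: "\<And>y. norm (f y) \<le> B"
    using schwartz_bounded[OF f] by (auto simp: bounded_iff)
  obtain C where C: "\<And>x y. norm (f y - f x) \<le> C * \<bar>y - x\<bar>"
    using schwartz_lipschitz[OF f] by blast
  have [measurable]: "f \<in> borel_measurable borel"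
    using schwartz_continuous_on[OF f] by (rule borel_measurable_continuous_onI)
  \<comment> \<open>Near \<open>0\<close> the Lipschitz bound cancels one power of \<open>u\<close>;
    what remains is integrable because \<open>\<alpha> < 1\<close>.\<close>
  have "set_integrable lborel {0<..1} (\<lambda>u. u powr (- \<alpha>))"
    using assms
    by (intro set_integrable_lborel_if_nonneg_integrable_on integrable_on_powr_from_0')
       (auto simp: set_borel_measurable_def)
  then have "set_integrable lborel {0<..1} (\<lambda>u. C * u powr (- \<alpha>))"
    by simp
  then have near: "set_integrable lborel {0<..1} ?g"
  proof (rule set_integrable_bound)
    show "set_borel_measurable lborel {0<..1} ?g"
      unfolding set_borel_measurable_def by measurable
    have "norm (?g u) \<le> norm (C * u powr (- \<alpha>))" if "u \<in> {0<..1}" for u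
    proof -
      have "norm (?g u) \<le> (C * u) / u powr (1 + \<alpha>)"
        using C[of "x + u" x] that by (simp add: divide_simps)
      also have "\<dots> = C * u powr (- \<alpha>)"
        using that by (simp add: powr_add powr_minus field_simps)
      finally show ?thesis
        by simp
    qed
    then show "AE u in lborel. u \<in> {0<..1} \<longrightarrow> norm (?g u) \<le> norm (C * u powr (- \<alpha>))"
      by simp
  qed
  \<comment> \<open>On the tail the numerator is at most \<open>2 * B\<close>, and the power is
    integrable at infinity because \<open>0 < \<alpha>\<close> puts its exponent below
    \<open>-1\<close>.\<close>
  have "(\<lambda>u::real. u powr (- (1 + \<alpha>))) integrable_on {1..}"
    using has_integral_powr_to_inf[of "- (1 + \<alpha>)" 1] assms by (auto simp: integrable_on_def)
  then have "set_integrable lborel {1..} (\<lambda>u::real. u powr (- (1 + \<alpha>)))"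
    by (intro set_integrable_lborel_if_nonneg_integrable_on)
       (auto simp: set_borel_measurable_def)
  then have "set_integrable lborel {1..} (\<lambda>u. (2 * B) * u powr (- (1 + \<alpha>)))"
    by (intro set_integrable_mult_right) auto
  then have far: "set_integrable lborel {1..} ?g"
  proof (rule set_integrable_bound)
    show "set_borel_measurable lborel {1..} ?g"
      unfolding set_borel_measurable_def by measurable
    have "norm (?g u) \<le> norm ((2 * B) * u powr (- (1 + \<alpha>)))" for u
    proof -
      have "norm (f (x + u) - f x) \<le> 2 * B"
        using norm_triangle_ineq4[of "f (x + u)" "f x"] B[of "x + u"] B[of x] by simp
      then have "norm (?g u) \<le> (2 * B) / u powr (1 + \<alpha>)"
        by (simp add: divide_inverse mult.commute[of "inverse _"] mult_right_mono)
      also have "\<dots> = (2 * B) * u powr (- (1 + \<alpha>))"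
        by (simp only: powr_minus divide_inverse)
      finally show ?thesis
        by simp
    qed
    then show "AE u in lborel. u \<in> {1..} \<longrightarrow> norm (?g u) \<le> norm ((2 * B) * u powr (- (1 + \<alpha>)))"
      by blast
  qed
  have "{0<..1} \<union> {1..} = {0::real<..}"
    by auto
  then have "set_integrable lborel {0<..} ?g"
    using set_integrable_Un[OF near far] by simp
  \<comment> \<open>Translation invariance of \<open>lborel\<close>, as the affine change of
    variables with slope \<open>1\<close> and offset \<open>x\<close>, undoes the
    substitution.\<close>
  then show ?thesis
    using lborel_integrable_real_affine_iff
      [of 1 "\<lambda>t. indicator {x<..} t *\<^sub>R ((f t - f x) /\<^sub>R (t - x) powr (1 + \<alpha>))" x]
    by (simp add: set_integrable_def indicator_def)
qed

text \<open>A vanishing integral forces \<open>h = 0\<close> almost everywhere on \<open>S\<close>.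
  By continuity the exceptional set is open, and an open null set is empty.\<close>

lemma set_integral_nonneg_eq_0_iff_continuous:
  fixes h :: "'a::euclidean_space \<Rightarrow> real"
  assumes "open S" "continuous_on S h" "\<And>t. t \<in> S \<Longrightarrow> 0 \<le> h t" "set_integrable lborel S h"
  shows "(LINT t:S|lborel. h t) = 0 \<longleftrightarrow> (\<forall>t\<in>S. h t = 0)"
proof
  assume "(LINT t:S|lborel. h t) = 0"
  then have "AE t in lborel. indicator S t *\<^sub>R h t = 0"
    using assms(3,4) unfolding set_lebesgue_integral_def set_integrable_def
    by (subst (asm) integral_nonneg_eq_0_iff_AE) (auto simp: indicator_def)
  \<comment> \<open>Negligible sets are the null sets of the completed measure, hence the passage
    from \<open>lborel\<close> to \<open>lebesgue\<close>.\<close>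
  then have "AE t in lebesgue. indicator S t *\<^sub>R h t = 0"
    by (rule AE_completion)
  then have "negligible {t. indicator S t *\<^sub>R h t \<noteq> 0}"
    by (simp add: completion.AE_iff_null_sets negligible_iff_null_sets)
  moreover have "{t. indicator S t *\<^sub>R h t \<noteq> 0} = S \<inter> h -` (- {0})"
    by (auto simp: indicator_def)
  moreover have "open (S \<inter> h -` (- {0}))"
    using assms(1,2) by (intro continuous_open_preimage) auto
  ultimately show "\<forall>t\<in>S. h t = 0"
    using open_not_negligible by fastforce
next
  assume "\<forall>t\<in>S. h t = 0"
  then have "(LINT t:S|lborel. h t) = (LINT t:S|lborel. 0)"
    using assms(1) by (intro set_lebesgue_integral_cong) auto
  then show "(LINT t:S|lborel. h t) = 0"
    by simp
qed

text \<open>The functional equation expresses the positive number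
  \<open>Gamma (1 - \<alpha>)\<close> as \<open>- \<alpha> * Gamma (- \<alpha>)\<close>. This sign
  reverses the inequality between the functions.\<close>

lemma Gamma_neg_less_0:
  assumes "0 < \<alpha>" "\<alpha> < (1::real)"
  shows "Gamma (- \<alpha>) < 0"
proof -
  \<comment> \<open>The functional equation must be used away from the poles;
    \<open>- \<alpha>\<close> lies strictly between the consecutive integers \<open>-1\<close> and
    \<open>0\<close>.\<close>
  have "- \<alpha> \<notin> \<int>\<^sub>\<le>\<^sub>0"
  proof
    assume "- \<alpha> \<in> \<int>\<^sub>\<le>\<^sub>0"
    then obtain n where "- \<alpha> = of_int n"
      by (auto elim: nonpos_Ints_cases)
    then have "- 1 < n" "n < 0"
      using assms by linarith+
    then show False
      by simp
  qed
  then have "Gamma (1 - \<alpha>) = - \<alpha> * Gamma (- \<alpha>)"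
    using Gamma_plus1[of "- \<alpha>"] by simp
  moreover have "0 < Gamma (1 - \<alpha>)"
    using assms by (intro Gamma_real_pos) simp
  ultimately show ?thesis
    using assms by (simp add: mult_less_0_iff)
qed

lemma D_right_zero: "D_right \<alpha> (\<lambda>_. 0) x = 0"
  by (simp add: D_right_def)

lemma D_right_comparison:
  fixes \<phi> \<psi> :: "real \<Rightarrow> real"
  assumes \<alpha>: "0 < \<alpha>" "\<alpha> < 1" and \<phi>: "\<phi> \<in> schwartz" and \<psi>: "\<psi> \<in> schwartz"
    and eq: "\<phi> x0 = \<psi> x0" and ge: "\<And>x. x \<ge> x0 \<Longrightarrow> \<psi> x \<le> \<phi> x"
  shows "D_right \<alpha> \<phi> x0 \<le> D_right \<alpha> \<psi> x0"
    and "D_right \<alpha> \<phi> x0 = D_right \<alpha> \<psi> x0 \<longleftrightarrow> (\<forall>x\<ge>x0. \<phi> x = \<psi> x)"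
proof -
  define h where "h t = (\<phi> t - \<psi> t) / (t - x0) powr (1 + \<alpha>)" for t
  note int = D_right_integrable[OF \<alpha> \<phi>, of x0] D_right_integrable[OF \<alpha> \<psi>, of x0]
  \<comment> \<open>The subtracted values at \<open>x0\<close> cancel by \<open>eq\<close>, so
    \<open>h\<close> is the difference of the two integrands.\<close>
  have h: "h = (\<lambda>t. (\<phi> t - \<phi> x0) /\<^sub>R (t - x0) powr (1 + \<alpha>) - (\<psi> t - \<psi> x0) /\<^sub>R (t - x0) powr (1 + \<alpha>))"
    by (simp add: fun_eq_iff h_def eq divide_inverse algebra_simps)
  have h_int: "set_integrable lborel {x0<..} h"
    unfolding h by (rule set_integral_diff(1)[OF int])
  have h_nonneg: "0 \<le> h t" if "t \<in> {x0<..}" for t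
    using ge[of t] that by (simp add: h_def)
  have diff: "D_right \<alpha> \<phi> x0 - D_right \<alpha> \<psi> x0 = (LINT t:{x0<..}|lborel. h t) / Gamma (- \<alpha>)"
    unfolding h D_right_def by (subst set_integral_diff(2)[OF int]) (simp add: diff_divide_distrib)
  have "0 \<le> (LINT t:{x0<..}|lborel. h t)"
    using h_nonneg unfolding set_lebesgue_integral_def
    by (intro Bochner_Integration.integral_nonneg) (auto simp: indicator_def)
  then show "D_right \<alpha> \<phi> x0 \<le> D_right \<alpha> \<psi> x0"
    using diff Gamma_neg_less_0[OF \<alpha>] divide_nonneg_neg by fastforce
  \<comment> \<open>On the open half-line \<open>t - x0\<close> never vanishes, so the quotient is
    continuous there.\<close>
  have "continuous_on {x0<..} h"
    unfolding h_def
    by (intro continuous_intros schwartz_continuous_on \<phi> \<psi>) auto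
  then have "(LINT t:{x0<..}|lborel. h t) = 0 \<longleftrightarrow> (\<forall>t\<in>{x0<..}. h t = 0)"
    using h_nonneg h_int by (intro set_integral_nonneg_eq_0_iff_continuous) auto
  \<comment> \<open>For \<open>t > x0\<close> the denominator is positive, so \<open>h t\<close>
    vanishes exactly when the two values agree; the endpoint \<open>x0\<close> is supplied by
    \<open>eq\<close>.\<close>
  also have "\<dots> \<longleftrightarrow> (\<forall>x\<ge>x0. \<phi> x = \<psi> x)"
    using eq by (auto simp: h_def order_le_less)
  finally show "D_right \<alpha> \<phi> x0 = D_right \<alpha> \<psi> x0 \<longleftrightarrow> (\<forall>x\<ge>x0. \<phi> x = \<psi> x)"
    using diff Gamma_neg_less_0[OF \<alpha>] by (auto simp: divide_eq_0_iff)
qed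

theorem theorem1p1:
  fixes \<alpha> :: real
  assumes "0 < \<alpha>" and "\<alpha> < 1"
  shows
    "(\<forall>(\<phi> :: real \<Rightarrow> real) x0.
       \<phi> \<in> schwartz \<longrightarrow> \<phi> x0 = 0 \<longrightarrow> (\<forall>x\<ge>x0. \<phi> x \<ge> 0) \<longrightarrow>
       D_right \<alpha> \<phi> x0 \<le> 0 \<and>
       (D_right \<alpha> \<phi> x0 = 0 \<longleftrightarrow> (\<forall>x\<ge>x0. \<phi> x = 0))) \<and>
     (\<forall>(\<phi> :: real \<Rightarrow> real) (\<psi> :: real \<Rightarrow> real) x0.
       \<phi> \<in> schwartz \<longrightarrow> \<psi> \<in> schwartz \<longrightarrow> \<phi> x0 = \<psi> x0 \<longrightarrow> (\<forall>x\<ge>x0. \<phi> x \<ge> \<psi> x) \<longrightarrow>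
       D_right \<alpha> \<phi> x0 \<le> D_right \<alpha> \<psi> x0 \<and>
       (D_right \<alpha> \<phi> x0 = D_right \<alpha> \<psi> x0 \<longleftrightarrow> (\<forall>x\<ge>x0. \<phi> x = \<psi> x)))"
  using D_right_comparison[OF assms] D_right_comparison[OF assms _ zero_in_schwartz]
  by (auto simp: D_right_zero)

end
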